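(* Let $G$ be a group with a finite generating set $X$. If $(G,X)$ has the loop shortening property, then $G$ is finitely presented and has a quadratic isoperimetric function.
   Context: $X^*$ denotes the set of all words in the letters of $X$ and their inverses, including the empty word, and $\Gamma(G,X)$ is the Cayley graph, a metric graph with edges of length $1$ and path metric $d$. A word $w\in X^*$ together with a starting vertex determines a path in $\Gamma(G,X)$ (called a path in $(G,X)$), of length $|w|$ equal to the number of letters. A loop is a path which starts and ends at the same vertex. A path or loop $w$ is parameterized by arc length: $w(t)$ is the point at distance $t$ along $w$ from its start point for $0\le t\le|w|$, and $w(t)$ is the endpoint of $w$ for $t>|w|$. Two paths (or loops) $w,u$, possibly with distinct start and end points, $k$-fellow travel if $d(w(t),u(t))\le k$ for all real $t\ge 0$. $(G,X)$ has the loop shortening property if there is a constant $k>0$ such that for each loop $w$ in $(G,X)$ of positive length there is a loop $u$ in $(G,X)$ with $|u|<|w|$ such that $w,u$ $k$-fellow travel ($u$ and $w$ may be disjoint and have different basepoints). If $G$ has a presentation $\langle X\mid R\rangle$ and $w\in X^*$ represents the identity of $G$, the area $A(w)$ is the minimum $m$ such that $w$ is freely equal to a product $\prod_{i=1}^m g_ir_ig_i^{-1}$ with $g_i$ in the free group $F(X)$ and $r_i\in R\cup R^{-1}$. The Dehn function of $\langle X\mid R\rangle$ is $\delta(n)=\max\{A(w): |w|\le n\}$ (over words $w$ representing the identity). An isoperimetric function for $\langle X\mid R\rangle$ is any function $f$ with $f(n)\ge\delta(n)$ for all $n$. $G$ has a quadratic isoperimetric function if some finite presentation of $G$ has an isoperimetric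 function that is a quadratic polynomial. (Functions $f,g$ are considered equivalent if each is bounded above by an expression of the form $Ag(Bn+C)+Dn+E$, respectively $A'f(B'n+C')+D'n+E'$; up to this equivalence the Dehn function does not depend on the choice of finite presentation.) *)

theory Defs
  imports
    Complex_Main
    "HOL-Algebra.Generated_Groups"
    "HOL-Computational_Algebra.Polynomial"
begin

section \<open>Words in the letters of a set and their inverses\<close>

text \<open>The letter \<open>(x, True)\<close> stands for x, and \<open>(x, False)\<close> for its formal inverse.\<close>

type_synonym 'x letter = "'x \<times> bool"
type_synonym 'x word = "'x letter list"

definition words :: "'x set \<Rightarrow> 'x word set" where
  "words X = lists (X \<times> UNIV)"

definition word_inv :: "'x word \<Rightarrow> 'x word" where
  "word_inv w = rev (map (\<lambda>(x, b). (x, \<not> b)) w)"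

fun letter_val :: "('a, 'b) monoid_scheme \<Rightarrow> 'a letter \<Rightarrow> 'a" where
  "letter_val G (x, b) = (if b then x else inv\<^bsub>G\<^esub> x)"

definition word_val :: "('a, 'b) monoid_scheme \<Rightarrow> 'a word \<Rightarrow> 'a" where
  "word_val G w = foldr (\<lambda>l a. letter_val G l \<otimes>\<^bsub>G\<^esub> a) w \<one>\<^bsub>G\<^esub>"


section \<open>The Cayley graph as a metric graph\<close>

text \<open>There is one edge of length 1 for each g in G and each x in X, joining g to gx.
  \<open>Inner g x s\<close>, for \<open>0 < s < 1\<close>, is the point of that edge at distance s from its end g.
  If x is an involution, the edges (g, x) and (gx, x) are thus distinct edges with the same ends.\<close>

datatype 'a cayley_point = Vertex 'a | Inner 'a 'a real

definition cayley_points :: "('a, 'b) monoid_scheme \<Rightarrow> 'a set \<Rightarrow> 'a cayley_point set" where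
  "cayley_points G X =
     Vertex ` carrier G \<union> {Inner g x s | g x s. g \<in> carrier G \<and> x \<in> X \<and> 0 < s \<and> s < 1}"

text \<open>The characteristic map of the edge (g, x), for s in [0, 1].\<close>

definition edge_point :: "('a, 'b) monoid_scheme \<Rightarrow> 'a \<Rightarrow> 'a \<Rightarrow> real \<Rightarrow> 'a cayley_point" where
  "edge_point G g x s =
     (if s = 0 then Vertex g else if s = 1 then Vertex (g \<otimes>\<^bsub>G\<^esub> x) else Inner g x s)"

text \<open>\<open>pl_path G X p l q\<close>: there is a piecewise linear path of length l from p to q, that is, a
  finite concatenation of segments each of which runs inside a single closed edge.  The path metric
  is the infimum of the lengths of such paths.\<close>

inductive pl_path ::
  "('a, 'b) monoid_scheme \<Rightarrow> 'a set \<Rightarrow> 'a cayley_point \<Rightarrow> real \<Rightarrow> 'a cayley_point \<Rightarrow> bool"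
  for G X where
  refl: "p \<in> cayley_points G X \<Longrightarrow> pl_path G X p 0 p"
| step: "pl_path G X p l (edge_point G g x s) \<Longrightarrow> g \<in> carrier G \<Longrightarrow> x \<in> X \<Longrightarrow>
         s \<in> {0..1} \<Longrightarrow> s' \<in> {0..1} \<Longrightarrow>
         pl_path G X p (l + \<bar>s - s'\<bar>) (edge_point G g x s')"

definition cayley_dist ::
  "('a, 'b) monoid_scheme \<Rightarrow> 'a set \<Rightarrow> 'a cayley_point \<Rightarrow> 'a cayley_point \<Rightarrow> real" where
  "cayley_dist G X p q = Inf {l. pl_path G X p l q}"


section \<open>Paths, loops and fellow travelling\<close>

text \<open>\<open>path_at G g w t\<close> is the point w(t) on the path labelled w starting at the vertex g.  A letter
  \<open>(x, False)\<close> read at the vertex h traverses backwards the edge labelled x ending in h.\<close>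

definition path_at :: "('a, 'b) monoid_scheme \<Rightarrow> 'a \<Rightarrow> 'a word \<Rightarrow> real \<Rightarrow> 'a cayley_point" where
  "path_at G g w t =
     (if real (length w) \<le> t then Vertex (g \<otimes>\<^bsub>G\<^esub> word_val G w)
      else let n = nat \<lfloor>t\<rfloor>; s = t - real n; h = g \<otimes>\<^bsub>G\<^esub> word_val G (take n w); x = fst (w ! n)
           in if snd (w ! n) then edge_point G h x s
              else edge_point G (h \<otimes>\<^bsub>G\<^esub> inv\<^bsub>G\<^esub> x) x (1 - s))"

definition is_loop :: "('a, 'b) monoid_scheme \<Rightarrow> 'a set \<Rightarrow> 'a \<Rightarrow> 'a word \<Rightarrow> bool" where
  "is_loop G X g w \<longleftrightarrow> g \<in> carrier G \<and> w \<in> words X \<and> g \<otimes>\<^bsub>G\<^esub> word_val G w = g"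

definition fellow_travel ::
  "('a, 'b) monoid_scheme \<Rightarrow> 'a set \<Rightarrow> real \<Rightarrow> 'a \<Rightarrow> 'a word \<Rightarrow> 'a \<Rightarrow> 'a word \<Rightarrow> bool" where
  "fellow_travel G X k g w h u \<longleftrightarrow>
     (\<forall>t\<ge>0. cayley_dist G X (path_at G g w t) (path_at G h u t) \<le> k)"

definition loop_shortening :: "('a, 'b) monoid_scheme \<Rightarrow> 'a set \<Rightarrow> bool" where
  "loop_shortening G X \<longleftrightarrow>
     (\<exists>k::real. k > 0 \<and> (\<forall>g w. is_loop G X g w \<and> length w > 0 \<longrightarrow>
        (\<exists>h u. is_loop G X h u \<and> length u < length w \<and> fellow_travel G X k g w h u)))"


section \<open>Free groups and presentations\<close>

inductive cancel_step :: "'x word \<Rightarrow> 'x word \<Rightarrow> bool" where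
  "cancel_step (u @ [(x, b), (x, \<not> b)] @ v) (u @ v)"

definition freely_equal :: "'x word \<Rightarrow> 'x word \<Rightarrow> bool" where
  "freely_equal = equivclp cancel_step"

definition free_rel :: "'x set \<Rightarrow> ('x word \<times> 'x word) set" where
  "free_rel X = {(u, v). u \<in> words X \<and> v \<in> words X \<and> freely_equal u v}"

definition free_class :: "'x set \<Rightarrow> 'x word \<Rightarrow> 'x word set" where
  "free_class X w = free_rel X `` {w}"

definition free_group :: "'x set \<Rightarrow> 'x word set monoid" where
  "free_group X =
     \<lparr>carrier = words X // free_rel X,
      monoid.mult = (\<lambda>A B. \<Union>u\<in>A. \<Union>v\<in>B. free_class X (u @ v)),
      one = free_class X []\<rparr>"

definition normal_closure :: "('a, 'b) monoid_scheme \<Rightarrow> 'a set \<Rightarrow> 'a set" where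
  "normal_closure G S = \<Inter>{N. N \<lhd> G \<and> S \<subseteq> N}"

definition relator_subgroup :: "'x set \<Rightarrow> 'x word set \<Rightarrow> 'x word set set" where
  "relator_subgroup X R = normal_closure (free_group X) (free_class X ` R)"

definition presented_group :: "'x set \<Rightarrow> 'x word set \<Rightarrow> 'x word set set monoid" where
  "presented_group X R = free_group X Mod relator_subgroup X R"

text \<open>The generators of a finite presentation are a finite set of symbols, which can be taken to be
  natural numbers: renaming generators changes neither the presented group up to isomorphism nor
  the areas of words.\<close>

definition finite_presentation_of ::
  "('a, 'b) monoid_scheme \<Rightarrow> nat set \<Rightarrow> nat word set \<Rightarrow> bool" where
  "finite_presentation_of G X R \<longleftrightarrow>
     finite X \<and> finite R \<and> R \<subseteq> words X \<and> G \<cong> presented_group X R"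

definition finitely_presented :: "('a, 'b) monoid_scheme \<Rightarrow> bool" where
  "finitely_presented G \<longleftrightarrow> (\<exists>X R. finite_presentation_of G X R)"


section \<open>Area, Dehn functions and isoperimetric functions\<close>

definition represents_one :: "'x set \<Rightarrow> 'x word set \<Rightarrow> 'x word \<Rightarrow> bool" where
  "represents_one X R w \<longleftrightarrow> w \<in> words X \<and>
     relator_subgroup X R #>\<^bsub>free_group X\<^esub> free_class X w = \<one>\<^bsub>presented_group X R\<^esub>"

text \<open>A list of pairs (g, r) encodes the product of the conjugates \<open>g r g\<^sup>-\<^sup>1\<close>.\<close>

definition conj_product :: "('x word \<times> 'x word) list \<Rightarrow> 'x word" where
  "conj_product ps = concat (map (\<lambda>(g, r). g @ r @ word_inv g) ps)"

definition area :: "'x set \<Rightarrow> 'x word set \<Rightarrow> 'x word \<Rightarrow> nat" where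
  "area X R w = (LEAST m. \<exists>ps. length ps = m \<and> set ps \<subseteq> words X \<times> (R \<union> word_inv ` R) \<and>
     freely_equal w (conj_product ps))"

definition dehn :: "'x set \<Rightarrow> 'x word set \<Rightarrow> nat \<Rightarrow> nat" where
  "dehn X R n = Max {area X R w | w. represents_one X R w \<and> length w \<le> n}"

definition isoperimetric_function :: "'x set \<Rightarrow> 'x word set \<Rightarrow> (nat \<Rightarrow> real) \<Rightarrow> bool" where
  "isoperimetric_function X R f \<longleftrightarrow> (\<forall>n. f n \<ge> real (dehn X R n))"

definition has_quadratic_isoperimetric_function :: "('a, 'b) monoid_scheme \<Rightarrow> bool" where
  "has_quadratic_isoperimetric_function G \<longleftrightarrow>
     (\<exists>X R. finite_presentation_of G X R \<and>
        (\<exists>p :: real poly. degree p = 2 \<and> isoperimetric_function X R (\<lambda>n. poly p (real n))))"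

end

theory Submission
  imports Defs
begin

text \<open>
  Let w be a nonempty word of length n that is trivial in G.  Read as a loop in the Cayley graph, it has a
  shorter loop u that k-fellow travels with it.  Joining w(i) to u(i), for i = 0, ..., n, by words
  of length at most some constant K cuts the annulus between the two loops into n cells, each with
  a boundary of length at most 2K + 2 (lemma \<open>loop_shortening_rungs\<close>).  Take as relators all words
  of length at most 2K + 2 that are trivial in G.  Then, in the free group, w is a product of n + 1
  conjugates of relators and of one conjugate of u (lemma \<open>annulus_filling\<close>); the additional
  relator comes from the two words that join the two base points, at the times 0 and n, which need
  not be the same word.  By induction on n, w is a product of at most
  \<open>(n + 1) + n + \<dots> + 1 \<le> (n + 1)\<^sup>2\<close> conjugates of relators (lemma \<open>quadratic_filling\<close>).  Hence the
  chosen relators, of which there are finitely many, normally generate the kernel of the map from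
  the free group onto G, and their Dehn function is at most \<open>(n + 1)\<^sup>2\<close>.
\<close>

section \<open>Free equality and free groups\<close>

lemma words_Nil [simp]: "[] \<in> words X"
  and words_Cons [simp]: "l # w \<in> words X \<longleftrightarrow> fst l \<in> X \<and> w \<in> words X"
  and words_append [simp]: "u @ v \<in> words X \<longleftrightarrow> u \<in> words X \<and> v \<in> words X"
  by (cases l; auto simp: words_def)+

lemma words_take_drop [simp]: "w \<in> words X \<Longrightarrow> take i w \<in> words X"
  "w \<in> words X \<Longrightarrow> drop i w \<in> words X"
  by (metis append_take_drop_id words_append)+

lemma word_inv_Nil [simp]: "word_inv [] = []"
  and word_inv_Cons: "word_inv (l # w) = word_inv w @ [(fst l, \<not> snd l)]"
  and word_inv_append [simp]: "word_inv (u @ v) = word_inv v @ word_inv u"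
  and word_inv_inv [simp]: "word_inv (word_inv w) = w"
  and length_word_inv [simp]: "length (word_inv w) = length w"
  by (auto simp: word_inv_def rev_map case_prod_unfold o_def)

lemma word_inv_words [simp]: "word_inv w \<in> words X \<longleftrightarrow> w \<in> words X"
  by (induction w) (auto simp: word_inv_Cons)

lemma finite_words_bounded: "finite X \<Longrightarrow> finite {w \<in> words X. length w \<le> n}"
  using finite_lists_length_le[of "X \<times> (UNIV :: bool set)" n]
  by (simp add: words_def lists_eq_set)

lemma freely_equal_refl [simp]: "freely_equal u u"
  by (simp add: freely_equal_def)

lemma freely_equal_sym: "freely_equal u v \<Longrightarrow> freely_equal v u"
  unfolding freely_equal_def by (rule equivclp_sym)

lemma freely_equal_trans [trans]: "freely_equal u v \<Longrightarrow> freely_equal v w \<Longrightarrow> freely_equal u w"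
  unfolding freely_equal_def by (rule equivclp_trans)

lemma freely_equal_induct [consumes 1, case_names refl step]:
  assumes "freely_equal u v" and "P u"
    and "\<And>v w. P v \<Longrightarrow> cancel_step v w \<or> cancel_step w v \<Longrightarrow> P w"
  shows "P v"
  using assms unfolding freely_equal_def by (induction rule: equivclp_induct) auto

lemma cancel_step_freely_equal: "cancel_step u v \<or> cancel_step v u \<Longrightarrow> freely_equal u v"
  unfolding freely_equal_def by (auto intro: r_into_equivclp converse_r_into_equivclp)

lemma cancel_step_context: "cancel_step u v \<Longrightarrow> cancel_step (a @ u @ b) (a @ v @ b)"
proof (induction rule: cancel_step.induct)
  case (1 p x c q)
  show ?case using cancel_step.intros[of "a @ p" x c "q @ b"] by simp
qed

lemma freely_equal_context: "freely_equal u v \<Longrightarrow> freely_equal (a @ u @ b) (a @ v @ b)"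
proof (induction rule: freely_equal_induct)
  case (step v w)
  then have "freely_equal (a @ v @ b) (a @ w @ b)"
    using cancel_step_context cancel_step_freely_equal by blast
  with step show ?case by (blast intro: freely_equal_trans)
qed simp

lemma freely_equal_append:
  assumes "freely_equal u u'" "freely_equal v v'"
  shows "freely_equal (u @ v) (u' @ v')"
proof -
  have "freely_equal (u @ v) (u' @ v)"
    using freely_equal_context[OF assms(1), of "[]" v] by simp
  also have "freely_equal \<dots> (u' @ v')"
    using freely_equal_context[OF assms(2), of u' "[]"] by simp
  finally show ?thesis .
qed

lemma freely_equal_cancel: "freely_equal (a @ v @ word_inv v @ b) (a @ b)"
proof (induction v arbitrary: a b)
  case (Cons l v)
  have "freely_equal (a @ (l # v) @ word_inv (l # v) @ b) (a @ [(fst l, snd l), (fst l, \<not> snd l)] @ b)"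
    using Cons[of "a @ [l]" "(fst l, \<not> snd l) # b"] by (simp add: word_inv_Cons)
  also have "freely_equal \<dots> (a @ b)"
    by (meson cancel_step.intros cancel_step_freely_equal)
  finally show ?case .
qed simp

lemma freely_equal_cancel': "freely_equal (a @ word_inv v @ v @ b) (a @ b)"
  using freely_equal_cancel[of a "word_inv v" b] by simp

lemma mem_free_class: "v \<in> free_class X w \<longleftrightarrow> w \<in> words X \<and> v \<in> words X \<and> freely_equal w v"
  by (auto simp: free_class_def free_rel_def)

lemma free_class_eq:
  assumes "freely_equal u v" "u \<in> words X" "v \<in> words X"
  shows "free_class X u = free_class X v"
  using assms unfolding set_eq_iff mem_free_class by (meson freely_equal_trans freely_equal_sym)

lemma free_group_carrier: "carrier (free_group X) = free_class X ` words X"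
  by (auto simp: free_group_def quotient_def free_class_def)

lemma free_class_closed [simp]: "w \<in> words X \<Longrightarrow> free_class X w \<in> carrier (free_group X)"
  by (simp add: free_group_carrier)

lemma free_group_one: "\<one>\<^bsub>free_group X\<^esub> = free_class X []"
  by (simp add: free_group_def)

lemma free_group_mult:
  assumes "u \<in> words X" "v \<in> words X"
  shows "free_class X u \<otimes>\<^bsub>free_group X\<^esub> free_class X v = free_class X (u @ v)"
proof -
  have "free_class X (u' @ v') = free_class X (u @ v)"
    if "u' \<in> free_class X u" "v' \<in> free_class X v" for u' v'
    using that
    by (intro free_class_eq freely_equal_append) (simp_all add: mem_free_class freely_equal_sym)
  then have "free_class X u \<otimes>\<^bsub>free_group X\<^esub> free_class X v =
      (\<Union>u'\<in>free_class X u. \<Union>v'\<in>free_class X v. free_class X (u @ v))"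
    unfolding free_group_def by (simp cong: SUP_cong)
  moreover have "u \<in> free_class X u" "v \<in> free_class X v"
    using assms by (auto simp: mem_free_class)
  ultimately show ?thesis by auto
qed

lemma free_group_inv_left:
  assumes "w \<in> words X"
  shows "free_class X (word_inv w) \<otimes>\<^bsub>free_group X\<^esub> free_class X w = \<one>\<^bsub>free_group X\<^esub>"
  using assms free_class_eq[OF freely_equal_cancel'[of "[]" w "[]", simplified]]
  by (simp add: free_group_mult free_group_one)

lemma group_free_group: "group (free_group X)"
proof (rule groupI)
  show "\<exists>y\<in>carrier (free_group X). y \<otimes>\<^bsub>free_group X\<^esub> x = \<one>\<^bsub>free_group X\<^esub>"
    if x: "x \<in> carrier (free_group X)" for x
  proof -
    from x obtain w where "w \<in> words X" "x = free_class X w" by (auto simp: free_group_carrier)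
    then show ?thesis using free_group_inv_left by (intro bexI[of _ "free_class X (word_inv w)"]) auto
  qed
qed (auto simp: free_group_carrier free_group_mult free_group_one)

lemma free_group_inv:
  assumes "w \<in> words X"
  shows "inv\<^bsub>free_group X\<^esub> (free_class X w) = free_class X (word_inv w)"
  using assms by (intro group.inv_equality[OF group_free_group] free_group_inv_left) auto


section \<open>Fillings by conjugates of relators\<close>

text \<open>The area of a word without a filling is an unspecified number, so a bound on the area does not
  say that a filling exists; this predicate does, and it bounds the area.\<close>

definition fillable :: "'x set \<Rightarrow> 'x word set \<Rightarrow> nat \<Rightarrow> 'x word \<Rightarrow> bool" where
  "fillable X R m w \<longleftrightarrow>
     (\<exists>ps. length ps \<le> m \<and> set ps \<subseteq> words X \<times> R \<and> freely_equal w (conj_product ps))"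

lemma fillable_mono: "fillable X R m w \<Longrightarrow> m \<le> n \<Longrightarrow> fillable X R n w"
  unfolding fillable_def by (meson le_trans)

lemma fillable_Nil: "fillable X R 0 []"
  unfolding fillable_def by (rule exI[of _ "[]"]) (simp add: conj_product_def)

lemma fillable_freely_equal: "fillable X R m u \<Longrightarrow> freely_equal w u \<Longrightarrow> fillable X R m w"
  unfolding fillable_def by (meson freely_equal_trans)

lemma fillable_conjugate_relator:
  assumes "g \<in> words X" "r \<in> R"
  shows "fillable X R 1 (g @ r @ word_inv g)"
  unfolding fillable_def
  by (rule exI[of _ "[(g, r)]"]) (use assms in \<open>simp add: conj_product_def\<close>)

lemma fillable_append:
  assumes "fillable X R m u" "fillable X R n v"
  shows "fillable X R (m + n) (u @ v)"
proof -
  from assms obtain ps qs where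
    "length ps \<le> m" "set ps \<subseteq> words X \<times> R" "freely_equal u (conj_product ps)"
    "length qs \<le> n" "set qs \<subseteq> words X \<times> R" "freely_equal v (conj_product qs)"
    unfolding fillable_def by blast
  then show ?thesis
    unfolding fillable_def
    by (intro exI[of _ "ps @ qs"]) (auto simp: conj_product_def freely_equal_append)
qed

lemma conj_product_conjugate:
  "freely_equal (g @ conj_product ps @ word_inv g) (conj_product (map (\<lambda>(h, r). (g @ h, r)) ps))"
proof (induction ps)
  case Nil
  show ?case using freely_equal_cancel[of "[]" g "[]"] by (simp add: conj_product_def)
next
  case (Cons p ps)
  obtain h r where p: "p = (h, r)" by force
  let ?c = "g @ h @ r @ word_inv h"
  have "freely_equal (?c @ conj_product ps @ word_inv g)
          (?c @ word_inv g @ g @ conj_product ps @ word_inv g)"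
    using freely_equal_sym[OF freely_equal_cancel'[of ?c g "conj_product ps @ word_inv g"]] by simp
  also have "freely_equal \<dots>
      ((?c @ word_inv g) @ conj_product (map (\<lambda>(h, r). (g @ h, r)) ps))"
    using freely_equal_append[OF freely_equal_refl[of "?c @ word_inv g"] Cons] by simp
  finally show ?case by (simp add: p conj_product_def)
qed

lemma fillable_conjugate:
  assumes "fillable X R m w" "g \<in> words X"
  shows "fillable X R m (g @ w @ word_inv g)"
proof -
  from assms obtain ps where ps: "length ps \<le> m" "set ps \<subseteq> words X \<times> R"
    "freely_equal w (conj_product ps)"
    unfolding fillable_def by blast
  have "freely_equal (g @ w @ word_inv g) (conj_product (map (\<lambda>(h, r). (g @ h, r)) ps))"
    using freely_equal_context[OF ps(3)] conj_product_conjugate by (rule freely_equal_trans)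
  with ps assms(2) show ?thesis
    unfolding fillable_def by (intro exI[of _ "map (\<lambda>(h, r). (g @ h, r)) ps"]) auto
qed

lemma area_le:
  assumes "fillable X R m w"
  shows "area X R w \<le> m"
proof -
  from assms obtain ps where "length ps \<le> m" "set ps \<subseteq> words X \<times> (R \<union> word_inv ` R)"
    "freely_equal w (conj_product ps)"
    unfolding fillable_def by blast
  then show ?thesis
    unfolding area_def by (intro le_trans[OF Least_le, of _ "length ps"]) auto
qed

text \<open>A filling of w by relators exhibits w as an element of every normal subgroup that contains
  the relators.\<close>

lemma fillable_in_normal:
  assumes "fillable X R m w" and w: "w \<in> words X" and R: "R \<subseteq> words X"
    and "N \<lhd> free_group X" and N: "free_class X ` R \<subseteq> N"
  shows "free_class X w \<in> N"
proof -
  interpret N: normal N "free_group X" by fact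
  from assms(1) obtain ps where ps: "set ps \<subseteq> words X \<times> R" "freely_equal w (conj_product ps)"
    unfolding fillable_def by blast
  from ps(1) have "conj_product ps \<in> words X \<and> free_class X (conj_product ps) \<in> N"
  proof (induction ps)
    case Nil
    show ?case using subgroup.one_closed[OF N.subgroup_axioms] by (simp add: conj_product_def flip: free_group_one)
  next
    case (Cons p ps)
    obtain g r where p: "p = (g, r)" by force
    have g: "g \<in> words X" and r: "r \<in> words X" "r \<in> R" using Cons.prems p R by auto
    have "free_class X g \<otimes>\<^bsub>free_group X\<^esub> free_class X r \<otimes>\<^bsub>free_group X\<^esub>
            inv\<^bsub>free_group X\<^esub> (free_class X g) \<in> N"
      using g r N by (intro N.inv_op_closed2) auto
    then have conj: "free_class X (g @ r @ word_inv g) \<in> N"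
      using g r by (simp add: free_group_inv free_group_mult)
    have IH: "conj_product ps \<in> words X" "free_class X (conj_product ps) \<in> N"
      using Cons by auto
    show ?case
      using subgroup.m_closed[OF N.subgroup_axioms conj IH(2)] IH(1) g r by (simp add: p free_group_mult conj_product_def)
  qed
  with ps(2) w show ?thesis using free_class_eq by metis
qed

text \<open>The words \<open>c i\<close> are the rungs of a ladder between w and u, and the relators the boundaries of
  its cells, each read from its corner on w.  Peeling off the last cell turns
  \<open>W\<^sub>i\<^sub>+\<^sub>1 c\<^sub>i\<^sub>+\<^sub>1 U\<^sub>i\<^sub>+\<^sub>1\<^sup>-\<^sup>1 c\<^sub>0\<^sup>-\<^sup>1\<close> into \<open>W\<^sub>i c\<^sub>i U\<^sub>i\<^sup>-\<^sup>1 c\<^sub>0\<^sup>-\<^sup>1\<close>, where \<open>W\<^sub>i\<close> and \<open>U\<^sub>i\<close> are the prefixes of length i.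
  A word that has come to its end contributes empty pieces from then on.\<close>

lemma ladder_filling:
  assumes w: "w \<in> words X" and u: "u \<in> words X"
    and cell: "\<And>i. i < n \<Longrightarrow>
      take 1 (drop i w) @ c (Suc i) @ word_inv (take 1 (drop i u)) @ word_inv (c i) \<in> R"
    and "i \<le> n"
  shows "fillable X R i (take i w @ c i @ word_inv (take i u) @ word_inv (c 0))"
  using \<open>i \<le> n\<close>
proof (induction i)
  case 0
  show ?case
    using fillable_freely_equal[OF fillable_Nil] freely_equal_cancel[of "[]" "c 0" "[]"] by simp
next
  case (Suc i)
  define W U x y where "W = take i w" and "U = take i u"
    and "x = take 1 (drop i w)" and "y = take 1 (drop i u)"
  have split: "take (Suc i) w = W @ x" "take (Suc i) u = U @ y"
    using take_add[of i 1] by (simp_all add: W_def U_def x_def y_def)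
  let ?r = "x @ c (Suc i) @ word_inv y @ word_inv (c i)"
  let ?e = "c i @ word_inv U @ word_inv (c 0)"
  have "fillable X R (1 + i) ((W @ ?r @ word_inv W) @ W @ ?e)"
    using Suc cell[of i] w
    by (intro fillable_append fillable_conjugate_relator) (auto simp: W_def U_def x_def y_def)
  moreover have "freely_equal ((W @ ?r @ word_inv W) @ W @ ?e) ((W @ ?r) @ ?e)"
    using freely_equal_cancel'[of "W @ ?r" W ?e] by simp
  moreover have "freely_equal ((W @ ?r) @ ?e)
      (take (Suc i) w @ c (Suc i) @ word_inv (take (Suc i) u) @ word_inv (c 0))"
    using freely_equal_cancel'[of "W @ x @ c (Suc i) @ word_inv y" "c i" "word_inv U @ word_inv (c 0)"]
    by (simp add: split)
  ultimately show ?case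
    unfolding plus_1_eq_Suc by (rule fillable_freely_equal[OF _ freely_equal_sym[OF freely_equal_trans]])
qed

text \<open>When w and u are loops, the first and last rungs of the ladder join the same two base points.
  The relator \<open>seam\<close> glues these rungs, which closes the ladder up to an annulus.\<close>

lemma annulus_filling:
  assumes w: "w \<in> words X" and u: "u \<in> words X" and c0: "c 0 \<in> words X"
    and "length u \<le> length w"
    and cell: "\<And>i. i < length w \<Longrightarrow>
      take 1 (drop i w) @ c (Suc i) @ word_inv (take 1 (drop i u)) @ word_inv (c i) \<in> R"
    and seam: "c 0 @ word_inv (c (length w)) \<in> R"
    and fill: "fillable X R m u"
  shows "fillable X R (length w + 1 + m) w"
proof -
  define d where "d = c (length w)"
  have "fillable X R (length w) (w @ d @ word_inv u @ word_inv (c 0))"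
    using ladder_filling[where n = "length w" and i = "length w", OF w u cell] \<open>length u \<le> length w\<close>
    by (simp add: d_def)
  moreover have "fillable X R m (c 0 @ u @ word_inv (c 0))"
    using fillable_conjugate[OF fill c0] .
  moreover have "fillable X R 1 (c 0 @ word_inv d)"
    using fillable_conjugate_relator[OF words_Nil seam] by (simp add: d_def)
  ultimately have "fillable X R (length w + (m + 1))
      ((w @ d @ word_inv u @ word_inv (c 0)) @ (c 0 @ u @ word_inv (c 0)) @ c 0 @ word_inv d)"
    by (intro fillable_append)
  moreover have "freely_equal
      ((w @ d @ word_inv u @ word_inv (c 0)) @ (c 0 @ u @ word_inv (c 0)) @ c 0 @ word_inv d) w"
  proof -
    have "freely_equal
        ((w @ d @ word_inv u @ word_inv (c 0)) @ (c 0 @ u @ word_inv (c 0)) @ c 0 @ word_inv d)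
        (w @ d @ word_inv u @ word_inv (c 0) @ c 0 @ u @ word_inv d)"
      using freely_equal_cancel'[of "w @ d @ word_inv u @ word_inv (c 0) @ c 0 @ u" "c 0" "word_inv d"]
      by simp
    also have "freely_equal \<dots> (w @ d @ word_inv u @ u @ word_inv d)"
      using freely_equal_cancel'[of "w @ d @ word_inv u" "c 0" "u @ word_inv d"] by simp
    also have "freely_equal \<dots> (w @ d @ word_inv d)"
      using freely_equal_cancel'[of "w @ d" u "word_inv d"] by simp
    also have "freely_equal \<dots> w"
      using freely_equal_cancel[of w d "[]"] by simp
    finally show ?thesis .
  qed
  ultimately have "fillable X R (length w + (m + 1)) w"
    by (rule fillable_freely_equal[OF _ freely_equal_sym])
  then show ?thesis by (rule fillable_mono) simp
qed


section \<open>The Cayley graph\<close>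

context group
begin

lemma letter_val_closed: "fst l \<in> carrier G \<Longrightarrow> letter_val G l \<in> carrier G"
  by (cases l) auto

lemma word_val_simps [simp]: "word_val G [] = \<one>"
  "word_val G (l # w) = letter_val G l \<otimes> word_val G w"
  by (simp_all add: word_val_def)

lemma word_val_closed [simp]: "w \<in> words (carrier G) \<Longrightarrow> word_val G w \<in> carrier G"
  by (induction w) (auto simp: letter_val_closed)

lemma word_val_append:
  "u \<in> words (carrier G) \<Longrightarrow> v \<in> words (carrier G) \<Longrightarrow>
   word_val G (u @ v) = word_val G u \<otimes> word_val G v"
  by (induction u) (auto simp: letter_val_closed m_assoc)

lemma word_val_inv:
  "w \<in> words (carrier G) \<Longrightarrow> word_val G (word_inv w) = inv (word_val G w)"
  by (induction w)
    (auto simp: word_inv_Cons word_val_append letter_val_closed inv_mult_group)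

lemma words_subset_carrier: "X \<subseteq> carrier G \<Longrightarrow> w \<in> words X \<Longrightarrow> w \<in> words (carrier G)"
  by (auto simp: words_def)

lemma generate_word_val:
  assumes "a \<in> generate G X" "X \<subseteq> carrier G"
  shows "\<exists>w\<in>words X. word_val G w = a"
  using assms(1)
proof (induction rule: generate.induct)
  case one
  show ?case by (rule bexI[of _ "[]"]) auto
next
  case (incl x)
  then show ?case using assms(2) by (intro bexI[of _ "[(x, True)]"]) auto
next
  case (inv x)
  then show ?case using assms(2) by (intro bexI[of _ "[(x, False)]"]) auto
next
  case (eng a b)
  then obtain u v where "u \<in> words X" "v \<in> words X" "word_val G u = a" "word_val G v = b" by blast
  then show ?case
    using words_subset_carrier[OF assms(2)] by (intro bexI[of _ "u @ v"]) (auto simp: word_val_append)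
qed

text \<open>At time i the next letter has just begun: a positive one is then at the parameter 0 of its edge,
  and an inverse one at the parameter 1 of the edge that it traverses backwards.  Both are the vertex
  reached after i letters.\<close>

lemma path_at_nat:
  assumes "X \<subseteq> carrier G" "g \<in> carrier G" "w \<in> words X"
  shows "path_at G g w (real i) = Vertex (g \<otimes> word_val G (take i w))"
proof (cases "length w \<le> i")
  case False
  have "w ! i \<in> X \<times> UNIV" using False assms(3) by (force simp: words_def lists_eq_set)
  then have "fst (w ! i) \<in> carrier G" using assms(1) by (auto simp: mem_Times_iff)
  moreover have "word_val G (take i w) \<in> carrier G"
    using assms words_subset_carrier by auto
  ultimately show ?thesis
    using False assms(2) by (simp add: path_at_def edge_point_def Let_def m_assoc)
qed (simp add: path_at_def)

lemma pl_path_word: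
  assumes X: "X \<subseteq> carrier G" and "g \<in> carrier G" and "w \<in> words X"
  shows "\<exists>l. pl_path G X (Vertex g) l (Vertex (g \<otimes> word_val G w))"
  using assms(3)
proof (induction w rule: rev_induct)
  case Nil
  show ?case using \<open>g \<in> carrier G\<close> by (auto intro!: exI pl_path.refl simp: cayley_points_def)
next
  case (snoc a w)
  obtain x b where a: "a = (x, b)" by force
  have x: "x \<in> X" "x \<in> carrier G" using snoc.prems X a by auto
  have w: "w \<in> words (carrier G)" using snoc.prems X words_subset_carrier by auto
  define h where "h = g \<otimes> word_val G w"
  have h: "h \<in> carrier G" using w assms(2) by (simp add: h_def)
  obtain l where l: "pl_path G X (Vertex g) l (Vertex h)"
    using snoc by (auto simp: h_def)
  have endpoint: "g \<otimes> word_val G (w @ [a]) = h \<otimes> letter_val G a"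
    using w x a assms(2) by (simp add: word_val_append h_def m_assoc)
  show ?case
  proof (cases b)
    case True
    have "pl_path G X (Vertex g) (l + \<bar>0 - 1\<bar>) (edge_point G h x 1)"
      using l h x by (intro pl_path.step) (auto simp: edge_point_def)
    then show ?thesis using endpoint a True by (auto simp: edge_point_def)
  next
    case False
    have "pl_path G X (Vertex g) (l + \<bar>1 - 0\<bar>) (edge_point G (h \<otimes> inv x) x 0)"
      using l h x by (intro pl_path.step) (auto simp: edge_point_def m_assoc)
    then show ?thesis using endpoint a False by (auto simp: edge_point_def)
  qed
qed

text \<open>A path of length l from a vertex to a point inside an edge first reaches one of the two ends
  of that edge by a word whose length, together with the distance from that end to the point, is
  at most l.  The second part of the conclusion makes the induction go through; the first is its
  limit case, for a point that is a vertex.\<close>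

lemma pl_path_imp_word:
  assumes X: "X \<subseteq> carrier G" and g: "g \<in> carrier G" and "pl_path G X (Vertex g) l q"
  shows "(\<forall>h. q = Vertex h \<longrightarrow> (\<exists>v\<in>words X. g \<otimes> word_val G v = h \<and> real (length v) \<le> l)) \<and>
    (\<forall>h x s. q = Inner h x s \<longrightarrow>
       (\<exists>v\<in>words X. g \<otimes> word_val G v = h \<and> real (length v) + s \<le> l) \<or>
       (\<exists>v\<in>words X. g \<otimes> word_val G v = h \<otimes> x \<and> real (length v) + (1 - s) \<le> l))"
  using assms(3)
proof (induction "Vertex g" l q rule: pl_path.induct)
  case refl
  show ?case using g by (auto intro: bexI[of _ "[]"])
next
  case (step l h x s s')
  define near where "near h' d \<longleftrightarrow> (\<exists>v\<in>words X. g \<otimes> word_val G v = h' \<and> real (length v) + d \<le> l + \<bar>s - s'\<bar>)"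
    for h' d
  have x: "x \<in> carrier G" using step X by auto
  have "(\<exists>v\<in>words X. g \<otimes> word_val G v = h \<and> real (length v) + s \<le> l) \<or>
     (\<exists>v\<in>words X. g \<otimes> word_val G v = h \<otimes> x \<and> real (length v) + (1 - s) \<le> l)"
    using step.hyps(2) by (auto simp: edge_point_def split: if_splits)
  then have near: "near h s' \<or> near (h \<otimes> x) (1 - s')"
    unfolding near_def by (elim disjE bexE conjE) (force+)
  have extend: "near (h' \<otimes> letter_val G (x, b)) d" if "near h' (1 + d)" for h' b d
  proof -
    from that obtain v where v: "v \<in> words X" "g \<otimes> word_val G v = h'"
        "real (length v) + (1 + d) \<le> l + \<bar>s - s'\<bar>"
      unfolding near_def by blast
    then have "v \<in> words (carrier G)" using X words_subset_carrier by blast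
    then have "g \<otimes> word_val G (v @ [(x, b)]) = h' \<otimes> letter_val G (x, b)"
      using x g v(2) by (auto simp: word_val_append m_assoc)
    then show ?thesis
      unfolding near_def using v(1,3) step.hyps(4) by (intro bexI[of _ "v @ [(x, b)]"]) auto
  qed
  have "near h 0" if "s' = 0"
    using near extend[of "h \<otimes> x" 0 False] that x step.hyps(3) by (auto simp: m_assoc)
  moreover have "near (h \<otimes> x) 0" if "s' = 1"
    using near extend[of h 0 True] that by auto
  ultimately show ?case
    using near by (auto simp: edge_point_def near_def)
qed

text \<open>The summand 1 leaves room for a path that is longer than the infimum, which the
  definition of the distance does not claim to be attained.\<close>

lemma cayley_dist_imp_word:
  assumes X: "X \<subseteq> carrier G" and gen: "generate G X = carrier G"
    and g: "g \<in> carrier G" and h: "h \<in> carrier G"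
    and dist: "cayley_dist G X (Vertex g) (Vertex h) \<le> k"
  shows "\<exists>v\<in>words X. g \<otimes> word_val G v = h \<and> real (length v) \<le> k + 1"
proof -
  \<comment> \<open>The infimum of the empty set would not say anything about paths.\<close>
  obtain w where w: "w \<in> words X" "word_val G w = inv g \<otimes> h"
    using generate_word_val[of "inv g \<otimes> h" X] X gen g h by auto
  then have "{l. pl_path G X (Vertex g) l (Vertex h)} \<noteq> {}"
    using pl_path_word[OF X g w(1)] g h by (simp add: m_assoc[symmetric])
  moreover have "Inf {l. pl_path G X (Vertex g) l (Vertex h)} < k + 1"
    using dist by (simp add: cayley_dist_def)
  ultimately obtain l where l: "pl_path G X (Vertex g) l (Vertex h)" "l < k + 1"
    using cInf_lessD by (metis mem_Collect_eq)
  obtain v where "v \<in> words X" "g \<otimes> word_val G v = h" "real (length v) \<le> l"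
    using pl_path_imp_word[OF X g l(1)] by blast
  with l(2) show ?thesis by (intro bexI[of _ v]) auto
qed

end


section \<open>Words in symbols for the generators\<close>

text \<open>The symbols of a presentation are not elements of G, so they are sent to G by \<open>\<phi>\<close>.  Free
  equality of two words in the symbols may pass through words in other symbols; sending all symbols
  to G makes evaluation invariant under every such step.\<close>

locale symbol_valuation = group G for G :: "('a, 'b) monoid_scheme" (structure) +
  fixes \<phi> :: "'x \<Rightarrow> 'a"
  assumes valuation_closed: "\<phi> y \<in> carrier G"
begin

definition ev :: "'x word \<Rightarrow> 'a" where
  "ev w = word_val G (map (map_prod \<phi> id) w)"

lemma map_valuation_words: "map (map_prod \<phi> id) w \<in> words (carrier G)"
  by (induction w) (auto simp: valuation_closed)

lemma ev_closed [simp]: "ev w \<in> carrier G"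
  by (simp add: ev_def map_valuation_words)

lemma ev_Nil [simp]: "ev [] = \<one>"
  by (simp add: ev_def)

lemma ev_append [simp]: "ev (u @ v) = ev u \<otimes> ev v"
  by (simp add: ev_def word_val_append map_valuation_words)

lemma ev_word_inv [simp]: "ev (word_inv w) = inv (ev w)"
proof -
  have "map (map_prod \<phi> id) (word_inv w) = word_inv (map (map_prod \<phi> id) w)"
    by (simp add: word_inv_def rev_map case_prod_unfold)
  then show ?thesis by (simp add: ev_def word_val_inv map_valuation_words)
qed

lemma ev_cancel_step: "cancel_step u v \<Longrightarrow> ev u = ev v"
proof (induction rule: cancel_step.induct)
  case (1 u x b v)
  have "ev [(x, b), (x, \<not> b)] = \<one>"
    using valuation_closed[of x] by (simp add: ev_def)
  then show ?case by (simp only: ev_append) simp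
qed

lemma ev_freely_equal: "freely_equal u v \<Longrightarrow> ev u = ev v"
  by (induction rule: freely_equal_induct) (auto dest: ev_cancel_step)

text \<open>At an integer time i, both loops are at a vertex, and the rung \<open>c i\<close> is a word that joins the two.
  As \<open>c 0\<close> joins the base points, its value is the base point of u seen from that of w, which lets
  the conclusion speak of values of words alone.\<close>

lemma loop_shortening_rungs:
  assumes gen: "generate G (\<phi> ` Y) = carrier G" and "loop_shortening G (\<phi> ` Y)"
  shows "\<exists>K. \<forall>w\<in>words Y. ev w = \<one> \<and> w \<noteq> [] \<longrightarrow>
    (\<exists>u\<in>words Y. ev u = \<one> \<and> length u < length w \<and>
       (\<exists>c. \<forall>i. c i \<in> words Y \<and> length (c i) \<le> K \<and>
          ev (take i w) \<otimes> ev (c i) = ev (c 0) \<otimes> ev (take i u)))"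
proof -
  let ?X = "\<phi> ` Y" and ?m = "map (map_prod \<phi> (id :: bool \<Rightarrow> bool))"
  have X: "?X \<subseteq> carrier G" using valuation_closed by auto
  have m_words: "?m v \<in> words ?X" if "v \<in> words Y" for v
    using that by (induction v) auto
  have lift: "\<exists>v\<in>words Y. ?m v = v'" if "v' \<in> words ?X" for v'
    using that
  proof (induction v')
    case (Cons l v')
    from Cons.prems obtain y where "y \<in> Y" "\<phi> y = fst l" by auto
    moreover have "v' \<in> words ?X" using Cons.prems by simp
    then obtain v where "v \<in> words Y" "?m v = v'" using Cons.IH by blast
    ultimately show ?case by (intro bexI[of _ "(y, snd l) # v"]) auto
  qed auto
  obtain k where shorten: "\<And>g w. is_loop G ?X g w \<Longrightarrow> length w > 0 \<Longrightarrow>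
      \<exists>h u. is_loop G ?X h u \<and> length u < length w \<and> fellow_travel G ?X k g w h u"
    using assms(2) unfolding loop_shortening_def by blast
  have "\<exists>u\<in>words Y. ev u = \<one> \<and> length u < length w \<and>
      (\<exists>c. \<forall>i. c i \<in> words Y \<and> length (c i) \<le> nat \<lfloor>k + 1\<rfloor> \<and>
         ev (take i w) \<otimes> ev (c i) = ev (c 0) \<otimes> ev (take i u))"
    if w: "w \<in> words Y" "ev w = \<one>" "w \<noteq> []" for w
  proof -
    have "is_loop G ?X \<one> (?m w)"
      using w m_words by (auto simp: is_loop_def ev_def[symmetric])
    then obtain h u' where u': "is_loop G ?X h u'" "length u' < length w"
        and fellow: "fellow_travel G ?X k \<one> (?m w) h u'"
      using shorten[of \<one> "?m w"] w(3) by auto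
    then obtain u where u: "u \<in> words Y" "?m u = u'"
      using lift[of u'] by (auto simp: is_loop_def)
    have h: "h \<in> carrier G" using u' by (simp add: is_loop_def)
    have "h \<otimes> ev u = h" using u' u(2) by (simp add: is_loop_def ev_def)
    then have "ev u = \<one>" using h by simp
    have "\<exists>c\<in>words Y. length c \<le> nat \<lfloor>k + 1\<rfloor> \<and> ev (take i w) \<otimes> ev c = h \<otimes> ev (take i u)" for i
    proof -
      have "cayley_dist G ?X (path_at G \<one> (?m w) (real i)) (path_at G h (?m u) (real i)) \<le> k"
        using fellow u(2) by (simp add: fellow_travel_def)
      then have "cayley_dist G ?X (Vertex (ev (take i w))) (Vertex (h \<otimes> ev (take i u))) \<le> k"
        using path_at_nat[OF X one_closed m_words[OF w(1)], of i]
          path_at_nat[OF X h m_words[OF u(1)], of i]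
        by (simp add: take_map ev_def[symmetric])
      then obtain v where v: "v \<in> words ?X" "ev (take i w) \<otimes> word_val G v = h \<otimes> ev (take i u)"
          "real (length v) \<le> k + 1"
        using cayley_dist_imp_word[OF X gen] h by (metis ev_closed m_closed)
      obtain c where "c \<in> words Y" "?m c = v" using lift[OF v(1)] by blast
      moreover from this have "ev c = word_val G v" "length c = length v" by (auto simp: ev_def)
      ultimately show ?thesis using v le_nat_floor[OF v(3)] by (intro bexI[of _ c]) simp_all
    qed
    then obtain c where c: "\<And>i. c i \<in> words Y" "\<And>i. length (c i) \<le> nat \<lfloor>k + 1\<rfloor>"
        "\<And>i. ev (take i w) \<otimes> ev (c i) = h \<otimes> ev (take i u)"
      by metis
    have "h = ev (c 0)" using c(3)[of 0] h by simp
    moreover have "length u < length w" using u(2) u'(2) by auto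
    ultimately show ?thesis using c u(1) \<open>ev u = \<one>\<close> by blast
  qed
  then show ?thesis by blast
qed

text \<open>One annulus costs \<open>length w + 1\<close> relators and leaves a word shorter than w, and
  \<open>(n + 1) + n\<^sup>2 \<le> (n + 1)\<^sup>2\<close>.  A cell is bounded by two rungs and at most one letter each of w and
  u, whence the length \<open>2 * K + 2\<close> of the relators.\<close>

lemma quadratic_filling:
  assumes gen: "generate G (\<phi> ` Y) = carrier G" and "loop_shortening G (\<phi> ` Y)"
  shows "\<exists>N. \<forall>w\<in>words Y. ev w = \<one> \<longrightarrow>
    fillable Y {r \<in> words Y. length r \<le> N \<and> ev r = \<one>} ((length w + 1)\<^sup>2) w"
proof -
  obtain K where rungs: "\<And>w. w \<in> words Y \<Longrightarrow> ev w = \<one> \<Longrightarrow> w \<noteq> [] \<Longrightarrow>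
    \<exists>u\<in>words Y. ev u = \<one> \<and> length u < length w \<and>
       (\<exists>c. \<forall>i. c i \<in> words Y \<and> length (c i) \<le> K \<and>
          ev (take i w) \<otimes> ev (c i) = ev (c 0) \<otimes> ev (take i u))"
    using loop_shortening_rungs[OF assms] by blast
  define R where "R = {r \<in> words Y. length r \<le> 2 * K + 2 \<and> ev r = \<one>}"
  have "fillable Y R ((length w + 1)\<^sup>2) w" if "w \<in> words Y" "ev w = \<one>" for w
    using that
  proof (induction w rule: length_induct)
    case (1 w)
    show ?case
    proof (cases "w = []")
      case True
      then show ?thesis using fillable_mono[OF fillable_Nil] by auto
    next
      case False
      obtain u c where u: "u \<in> words Y" "ev u = \<one>" "length u < length w"
        and c: "\<And>i. c i \<in> words Y" "\<And>i. length (c i) \<le> K"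
          "\<And>i. ev (take i w) \<otimes> ev (c i) = ev (c 0) \<otimes> ev (take i u)"
        using rungs[OF 1(2,3) False] by blast
      have cell: "take 1 (drop i w) @ c (Suc i) @ word_inv (take 1 (drop i u)) @ word_inv (c i) \<in> R"
        for i
      proof -
        define W U x y where "W = take i w" and "U = take i u"
          and "x = take 1 (drop i w)" and "y = take 1 (drop i u)"
        have split: "take (Suc i) w = W @ x" "take (Suc i) u = U @ y"
          using take_add[of i 1] by (simp_all add: W_def U_def x_def y_def)
        have "ev W \<otimes> (ev x \<otimes> ev (c (Suc i))) = ev (c 0) \<otimes> ev U \<otimes> ev y"
          using c(3)[of "Suc i"] by (simp add: split m_assoc)
        also have "\<dots> = ev W \<otimes> (ev (c i) \<otimes> ev y)"
          using c(3)[of i] by (simp add: W_def U_def m_assoc[symmetric])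
        finally have "ev x \<otimes> ev (c (Suc i)) = ev (c i) \<otimes> ev y" by simp
        then have "ev x \<otimes> ev (c (Suc i)) \<otimes> inv (ev (c i) \<otimes> ev y) = \<one>" by simp
        then have "ev (x @ c (Suc i) @ word_inv y @ word_inv (c i)) = \<one>"
          by (simp add: m_assoc inv_mult_group)
        moreover have "length x \<le> 1" "length y \<le> 1" by (auto simp: x_def y_def)
        moreover have "x \<in> words Y" "y \<in> words Y" using 1(2) u(1) by (auto simp: x_def y_def)
        ultimately have "x @ c (Suc i) @ word_inv y @ word_inv (c i) \<in> R"
          using c(1)[of i] c(1)[of "Suc i"] c(2)[of i] c(2)[of "Suc i"] by (simp add: R_def)
        then show ?thesis by (simp only: x_def y_def)
      qed
      have "ev (c (length w)) = ev (c 0)"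
        using c(3)[of "length w"] 1(3) u(2,3) by simp
      then have seam: "c 0 @ word_inv (c (length w)) \<in> R"
        using c(1) c(2)[of 0] c(2)[of "length w"] by (simp add: R_def)
      have "fillable Y R (length w + 1 + (length u + 1)\<^sup>2) w"
        using annulus_filling[OF 1(2) u(1) c(1) less_imp_le[OF u(3)] cell seam] 1 u by blast
      moreover have "length w + 1 + (length u + 1)\<^sup>2 \<le> (length w + 1)\<^sup>2"
      proof -
        have "(length u + 1)\<^sup>2 \<le> (length w)\<^sup>2" using u(3) by (intro power_mono) auto
        then show ?thesis by (simp add: power2_eq_square)
      qed
      ultimately show ?thesis by (rule fillable_mono)
    qed
  qed
  then show ?thesis unfolding R_def by blast
qed


section \<open>The presentation\<close>

definition class_ev :: "'x word set \<Rightarrow> 'a" where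
  "class_ev A = ev (SOME w. w \<in> A)"

lemma class_ev_free_class [simp]: "w \<in> words Y \<Longrightarrow> class_ev (free_class Y w) = ev w"
proof -
  assume "w \<in> words Y"
  then have "w \<in> free_class Y w" by (simp add: mem_free_class)
  then have "(SOME v. v \<in> free_class Y w) \<in> free_class Y w" by (rule someI)
  then show ?thesis by (auto simp: mem_free_class class_ev_def dest: ev_freely_equal)
qed

lemma group_hom_class_ev: "group_hom (free_group Y) G class_ev"
proof -
  interpret F: group "free_group Y" by (rule group_free_group)
  show ?thesis
    by unfold_locales (auto simp: hom_def free_group_carrier free_group_mult)
qed

lemma relator_subgroup_eq_kernel:
  assumes R: "R \<subseteq> words Y" and trivial: "\<And>r. r \<in> R \<Longrightarrow> ev r = \<one>"
    and fill: "\<And>w. w \<in> words Y \<Longrightarrow> ev w = \<one> \<Longrightarrow> \<exists>m. fillable Y R m w"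
  shows "relator_subgroup Y R = kernel (free_group Y) G class_ev"
proof
  interpret h: group_hom "free_group Y" G class_ev by (rule group_hom_class_ev)
  have "free_class Y ` R \<subseteq> kernel (free_group Y) G class_ev"
    using R trivial by (auto simp: kernel_def subset_iff)
  then show "relator_subgroup Y R \<subseteq> kernel (free_group Y) G class_ev"
    using h.normal_kernel by (auto simp: relator_subgroup_def normal_closure_def)
  show "kernel (free_group Y) G class_ev \<subseteq> relator_subgroup Y R"
    using fill fillable_in_normal[OF _ _ R]
    by (fastforce simp: kernel_def free_group_carrier relator_subgroup_def normal_closure_def)
qed

lemma iso_presented_group:
  assumes kernel: "relator_subgroup Y R = kernel (free_group Y) G class_ev"
    and gen: "generate G (\<phi> ` Y) = carrier G"
  shows "G \<cong> presented_group Y R"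
proof -
  interpret h: group_hom "free_group Y" G class_ev by (rule group_hom_class_ev)
  have X: "\<phi> ` Y \<subseteq> carrier G" using valuation_closed by auto
  have "a \<in> class_ev ` carrier (free_group Y)" if "a \<in> carrier G" for a
    using that unfolding gen[symmetric]
  proof (induction rule: generate.induct)
    case one
    show ?case by (auto intro!: image_eqI[of _ _ "\<one>\<^bsub>free_group Y\<^esub>"])
  next
    case (incl x)
    then obtain y where "y \<in> Y" "x = ev [(y, True)]"
      using valuation_closed by (auto simp: ev_def)
    then show ?case by (intro image_eqI[of _ _ "free_class Y [(y, True)]"]) auto
  next
    case (inv x)
    then obtain y where "y \<in> Y" "inv x = ev [(y, False)]"
      using valuation_closed by (auto simp: ev_def)
    then show ?case by (intro image_eqI[of _ _ "free_class Y [(y, False)]"]) auto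
  next
    case (eng a b)
    then obtain A B where "A \<in> carrier (free_group Y)" "B \<in> carrier (free_group Y)"
      "a = class_ev A" "b = class_ev B" by blast
    then show ?case by (intro image_eqI[of _ _ "A \<otimes>\<^bsub>free_group Y\<^esub> B"]) auto
  qed
  then have "class_ev ` carrier (free_group Y) = carrier G" using h.hom_closed by blast
  then have "presented_group Y R \<cong> G"
    unfolding presented_group_def kernel by (rule h.FactGroup_iso)
  moreover have "group (presented_group Y R)"
    unfolding presented_group_def kernel
    using h.normal_kernel by (rule normal.factorgroup_is_group)
  ultimately show ?thesis by (simp add: group.iso_sym)
qed

lemma represents_one_iff:
  assumes "relator_subgroup Y R = kernel (free_group Y) G class_ev"
  shows "represents_one Y R w \<longleftrightarrow> w \<in> words Y \<and> ev w = \<one>"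
proof (cases "w \<in> words Y")
  case True
  interpret h: group_hom "free_group Y" G class_ev by (rule group_hom_class_ev)
  let ?N = "kernel (free_group Y) G class_ev"
  have "?N #>\<^bsub>free_group Y\<^esub> free_class Y w = ?N \<longleftrightarrow> free_class Y w \<in> ?N"
    using True h.subgroup_kernel h.coset_join1 h.coset_join2 free_class_closed by metis
  then show ?thesis
    using True by (simp add: represents_one_def presented_group_def FactGroup_def assms kernel_def)
qed (simp add: represents_one_def)

end

lemma dehn_le:
  assumes "finite X" and "represents_one X R []"
    and "\<And>w. represents_one X R w \<Longrightarrow> length w \<le> n \<Longrightarrow> area X R w \<le> m"
  shows "dehn X R n \<le> m"
proof -
  let ?S = "{w. represents_one X R w \<and> length w \<le> n}"
  have eq: "{area X R w | w. represents_one X R w \<and> length w \<le> n} = area X R ` ?S" by blast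
  have "finite ?S"
    using finite_words_bounded[OF assms(1), of n] by (rule rev_finite_subset) (auto simp: represents_one_def)
  moreover have "[] \<in> ?S" using assms(2) by simp
  ultimately show ?thesis
    unfolding dehn_def eq using assms(3) by (subst Max_le_iff) auto
qed


theorem theorem4p1:
  fixes G :: "('a, 'b) monoid_scheme" and X :: "'a set"
  assumes "group G"
    and "finite X" and "X \<subseteq> carrier G" and "generate G X = carrier G"
    and "loop_shortening G X"
  shows "finitely_presented G \<and> has_quadratic_isoperimetric_function G"
proof -
  obtain n :: nat and f where f: "X = f ` {i. i < n}"
    using finite_imp_nat_seg_image_inj_on[OF \<open>finite X\<close>] by blast
  define Y \<phi> where "Y = {i. i < n}" and "\<phi> i = (if i < n then f i else \<one>\<^bsub>G\<^esub>)" for i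
  have X: "X = \<phi> ` Y" by (auto simp: f Y_def \<phi>_def)
  interpret group G by fact
  interpret symbol_valuation G \<phi>
    by unfold_locales (use \<open>X \<subseteq> carrier G\<close> in \<open>auto simp: \<phi>_def f\<close>)
  obtain N where fill: "\<And>w. w \<in> words Y \<Longrightarrow> ev w = \<one>\<^bsub>G\<^esub> \<Longrightarrow>
      fillable Y {r \<in> words Y. length r \<le> N \<and> ev r = \<one>\<^bsub>G\<^esub>} ((length w + 1)\<^sup>2) w"
    using quadratic_filling[of Y] assms(4,5) unfolding X by blast
  define R where "R = {r \<in> words Y. length r \<le> N \<and> ev r = \<one>\<^bsub>G\<^esub>}"
  have kernel: "relator_subgroup Y R = kernel (free_group Y) G class_ev"
    using fill by (intro relator_subgroup_eq_kernel) (auto simp: R_def)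
  have "finite Y" by (simp add: Y_def)
  moreover have "finite R"
    using finite_words_bounded[OF \<open>finite Y\<close>, of N] by (rule rev_finite_subset) (auto simp: R_def)
  moreover have "G \<cong> presented_group Y R"
    using iso_presented_group[OF kernel] assms(4) X by simp
  ultimately have pres: "finite_presentation_of G Y R"
    by (auto simp: finite_presentation_of_def R_def)
  have "dehn Y R n \<le> (n + 1)\<^sup>2" for n
  proof (rule dehn_le[OF \<open>finite Y\<close>])
    show "represents_one Y R []" by (simp add: represents_one_iff[OF kernel])
    show "area Y R w \<le> (n + 1)\<^sup>2" if "represents_one Y R w" "length w \<le> n" for w
    proof -
      have "area Y R w \<le> (length w + 1)\<^sup>2"
        using that(1) fill[of w, folded R_def] represents_one_iff[OF kernel, of w] by (intro area_le) blast
      also have "\<dots> \<le> (n + 1)\<^sup>2" using that(2) by (intro power_mono) auto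
      finally show ?thesis .
    qed
  qed
  then have "real (dehn Y R n) \<le> poly [:1, 2, 1:] (real n)" for n
    using of_nat_le_iff[where 'a = real, of "dehn Y R n" "(n + 1)\<^sup>2"]
    by (simp add: power2_eq_square algebra_simps)
  then have "isoperimetric_function Y R (\<lambda>n. poly [:1, 2, 1:] (real n))"
    by (simp add: isoperimetric_function_def)
  moreover have "degree [:1, 2, 1 :: real:] = 2" by simp
  ultimately show ?thesis
    using pres unfolding finitely_presented_def has_quadratic_isoperimetric_function_def by blast
qed

end
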